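(* Let $u,v$ be the standard generating pair of $\mathbb{Z}\times\mathbb{Z}$ (written multiplicatively), and let $\theta:\mathbb{Z}\times\mathbb{Z}\to\mathbb{Z}\times\mathbb{Z}$ be the (injective) endomorphism given by $\theta(u)=u^5v^{-1}$ and $\theta(v)=u^2$. Let $G=\langle t,\mathbb{Z}\times\mathbb{Z}\rangle$ be the ascending HNN extension of $\mathbb{Z}\times\mathbb{Z}$ with stable letter $t$ formed using $\theta$, so that $txt^{-1}=\theta(x)$ for all $x\in\mathbb{Z}\times\mathbb{Z}$. Then $G$ is soluble, $G$ is not LERF, and $G$ does not contain a strictly ascending HNN extension of a cyclic group (that is, no subgroup of $G$ is a strictly ascending HNN extension whose base is a cyclic group).
   Context: A group is LERF (locally extended residually finite) if every finitely generated subgroup is an intersection of finite index subgroups. Given a group $B$ and an isomorphism $\theta$ from $B$ onto a subgroup $A$ of $B$, the ascending HNN extension $\langle t,B\rangle$ with base $B$ and stable letter $t$ is the group obtained from the free product $B*\langle t\rangle$ (with $t$ of infinite order) by adding the relations $tbt^{-1}=\theta(b)$ for all $b\in B$. It is strictly ascending if $A\neq B$, i.e. if $tBt^{-1}$ is a proper subgroup of $B$. A subgroup $H$ of a group $G$ is said to be a strictly ascending HNN extension with base $B$ and stable letter $t$ if $B\leq H$, $t\in H$, $H$ is generated by $t$ and $B$, $tBt^{-1}\subsetneq B$, and the natural map from the abstract ascending HNN extension of $B$ defined by $b\mapsto tbt^{-1}$ to $H$ is an isomorphism. A group "contains a strictly ascending HNN extension of a group of a certain type" if it has a subgroup that is a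 strictly ascending HNN extension whose base is of that type. *)

theory Defs
  imports "HOL-Algebra.Solvable_Groups" "HOL-Algebra.Elementary_Groups"
begin

section \<open>Free products\<close>

text \<open>The free product of \<open>G\<close> and \<open>H\<close> consists of the words in the letters \<open>Inl x\<close>
  (\<open>x \<in> carrier G\<close>) and \<open>Inr y\<close> (\<open>y \<in> carrier H\<close>), modulo the congruence generated by deleting a
  letter that is an identity element and by multiplying two adjacent letters from the same factor.\<close>

abbreviation fp_words :: "('a, 'c) monoid_scheme \<Rightarrow> ('b, 'd) monoid_scheme \<Rightarrow> ('a + 'b) list set"
  where "fp_words G H \<equiv> lists (carrier G <+> carrier H)"

inductive_set fp_cong ::
  "('a, 'c) monoid_scheme \<Rightarrow> ('b, 'd) monoid_scheme \<Rightarrow> (('a + 'b) list \<times> ('a + 'b) list) set"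
  for G H where
  refl: "w \<in> fp_words G H \<Longrightarrow> (w, w) \<in> fp_cong G H"
| sym: "(v, w) \<in> fp_cong G H \<Longrightarrow> (w, v) \<in> fp_cong G H"
| trans: "\<lbrakk>(u, v) \<in> fp_cong G H; (v, w) \<in> fp_cong G H\<rbrakk> \<Longrightarrow> (u, w) \<in> fp_cong G H"
| one_left: "\<lbrakk>p \<in> fp_words G H; q \<in> fp_words G H\<rbrakk>
    \<Longrightarrow> (p @ [Inl \<one>\<^bsub>G\<^esub>] @ q, p @ q) \<in> fp_cong G H"
| one_right: "\<lbrakk>p \<in> fp_words G H; q \<in> fp_words G H\<rbrakk>
    \<Longrightarrow> (p @ [Inr \<one>\<^bsub>H\<^esub>] @ q, p @ q) \<in> fp_cong G H"
| mult_left: "\<lbrakk>p \<in> fp_words G H; q \<in> fp_words G H; x \<in> carrier G; x' \<in> carrier G\<rbrakk>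
    \<Longrightarrow> (p @ [Inl x, Inl x'] @ q, p @ [Inl (x \<otimes>\<^bsub>G\<^esub> x')] @ q) \<in> fp_cong G H"
| mult_right: "\<lbrakk>p \<in> fp_words G H; q \<in> fp_words G H; y \<in> carrier H; y' \<in> carrier H\<rbrakk>
    \<Longrightarrow> (p @ [Inr y, Inr y'] @ q, p @ [Inr (y \<otimes>\<^bsub>H\<^esub> y')] @ q) \<in> fp_cong G H"

definition free_product ::
  "('a, 'c) monoid_scheme \<Rightarrow> ('b, 'd) monoid_scheme \<Rightarrow> ('a + 'b) list set monoid"
  where "free_product G H =
    \<lparr>carrier = fp_words G H // fp_cong G H,
     monoid.mult = (\<lambda>V W. (\<Union>v\<in>V. \<Union>w\<in>W. fp_cong G H `` {v @ w})),
     one = fp_cong G H `` {[]}\<rparr>"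

definition fp_inl ::
  "('a, 'c) monoid_scheme \<Rightarrow> ('b, 'd) monoid_scheme \<Rightarrow> 'a \<Rightarrow> ('a + 'b) list set"
  where "fp_inl G H x = fp_cong G H `` {[Inl x]}"

definition fp_inr ::
  "('a, 'c) monoid_scheme \<Rightarrow> ('b, 'd) monoid_scheme \<Rightarrow> 'b \<Rightarrow> ('a + 'b) list set"
  where "fp_inr G H y = fp_cong G H `` {[Inr y]}"

definition normal_closure :: "('a, 'c) monoid_scheme \<Rightarrow> 'a set \<Rightarrow> 'a set"
  where "normal_closure G S = \<Inter> {N. N \<lhd> G \<and> S \<subseteq> N}"


section \<open>Ascending HNN extensions\<close>

text \<open>The infinite cyclic group generated by the stable letter is \<^const>\<open>integer_group\<close>, with the
  stable letter itself corresponding to \<open>1\<close>. The construction makes sense for every map \<open>\<theta>\<close>; it is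
  the ascending HNN extension when \<open>\<theta>\<close> is an injective endomorphism of \<open>B\<close>, that is, an isomorphism
  from \<open>B\<close> onto a subgroup of \<open>B\<close>.\<close>

definition hnn_relators ::
  "('a, 'c) monoid_scheme \<Rightarrow> ('a \<Rightarrow> 'a) \<Rightarrow> ('a + int) list set set"
  where "hnn_relators B \<theta> =
    (let F = free_product B integer_group;
         \<iota> = fp_inl B integer_group;
         t = fp_inr B integer_group 1
     in {t \<otimes>\<^bsub>F\<^esub> \<iota> b \<otimes>\<^bsub>F\<^esub> inv\<^bsub>F\<^esub> t \<otimes>\<^bsub>F\<^esub> inv\<^bsub>F\<^esub> (\<iota> (\<theta> b)) | b. b \<in> carrier B})"

definition asc_hnn ::
  "('a, 'c) monoid_scheme \<Rightarrow> ('a \<Rightarrow> 'a) \<Rightarrow> ('a + int) list set set monoid"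
  where "asc_hnn B \<theta> = free_product B integer_group Mod
    normal_closure (free_product B integer_group) (hnn_relators B \<theta>)"

definition hnn_base ::
  "('a, 'c) monoid_scheme \<Rightarrow> ('a \<Rightarrow> 'a) \<Rightarrow> 'a \<Rightarrow> ('a + int) list set set"
  where "hnn_base B \<theta> b =
    normal_closure (free_product B integer_group) (hnn_relators B \<theta>)
      #>\<^bsub>free_product B integer_group\<^esub> fp_inl B integer_group b"

definition hnn_stable ::
  "('a, 'c) monoid_scheme \<Rightarrow> ('a \<Rightarrow> 'a) \<Rightarrow> ('a + int) list set set"
  where "hnn_stable B \<theta> =
    normal_closure (free_product B integer_group) (hnn_relators B \<theta>)
      #>\<^bsub>free_product B integer_group\<^esub> fp_inr B integer_group 1"

text \<open>\<open>H\<close> is, as a subgroup of \<open>G\<close>, a strictly ascending HNN extension with base \<open>B\<close> and stable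
  letter \<open>t\<close>. The natural map from the abstract extension is the only homomorphism that sends the
  copy of each \<open>b \<in> B\<close> to \<open>b\<close> and the abstract stable letter to \<open>t\<close>.\<close>

definition strictly_ascending_hnn ::
  "('a, 'c) monoid_scheme \<Rightarrow> 'a set \<Rightarrow> 'a set \<Rightarrow> 'a \<Rightarrow> bool"
  where "strictly_ascending_hnn G H B t \<longleftrightarrow>
    subgroup H G \<and> subgroup B G \<and> B \<subseteq> H \<and> t \<in> H \<and> H = generate G (insert t B) \<and>
    (\<lambda>b. t \<otimes>\<^bsub>G\<^esub> b \<otimes>\<^bsub>G\<^esub> inv\<^bsub>G\<^esub> t) ` B \<subset> B \<and>
    (let B' = G\<lparr>carrier := B\<rparr>; \<theta> = (\<lambda>b. t \<otimes>\<^bsub>G\<^esub> b \<otimes>\<^bsub>G\<^esub> inv\<^bsub>G\<^esub> t)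
     in \<exists>\<phi> \<in> iso (asc_hnn B' \<theta>) (G\<lparr>carrier := H\<rparr>).
          (\<forall>b\<in>B. \<phi> (hnn_base B' \<theta> b) = b) \<and> \<phi> (hnn_stable B' \<theta>) = t)"


section \<open>LERF groups\<close>

text \<open>The family of finite index subgroups is required to be nonempty because the empty
  intersection of sets would be the whole type; \<open>G\<close> itself is the intersection of \<open>{G}\<close>.\<close>

definition LERF :: "('a, 'c) monoid_scheme \<Rightarrow> bool"
  where "LERF G \<longleftrightarrow>
    (\<forall>S. finite S \<and> S \<subseteq> carrier G \<longrightarrow>
      (\<exists>\<K>. \<K> \<noteq> {} \<and> (\<forall>K\<in>\<K>. subgroup K G \<and> finite (rcosets\<^bsub>G\<^esub> K)) \<and>
        generate G S = \<Inter> \<K>))"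


section \<open>The group \<open>\<int> \<times> \<int>\<close>\<close>

abbreviation ZZ :: "(int \<times> int) monoid"
  where "ZZ \<equiv> integer_group \<times>\<times> integer_group"

abbreviation zz_u :: "int \<times> int" where "zz_u \<equiv> (1, 0)"
abbreviation zz_v :: "int \<times> int" where "zz_v \<equiv> (0, 1)"


section \<open>Basic facts\<close>

lemma normal_carrier:
  assumes "group G" shows "carrier G \<lhd> G"
proof -
  interpret group G by fact
  show ?thesis by (simp add: normal_inv_iff subgroup_self)
qed

lemma normal_closure_normal:
  assumes "group G" "S \<subseteq> carrier G"
  shows "normal_closure G S \<lhd> G" "S \<subseteq> normal_closure G S"
proof -
  interpret group G by fact
  let ?\<N> = "{N. N \<lhd> G \<and> S \<subseteq> N}"
  have ne: "?\<N> \<noteq> {}" using normal_carrier assms by blast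
  have "subgroup (\<Inter> ?\<N>) G"
    by (rule subgroups_Inter) (use ne in \<open>auto simp: normal_inv_iff\<close>)
  then show "normal_closure G S \<lhd> G"
    unfolding normal_closure_def by (auto simp: normal_inv_iff)
  show "S \<subseteq> normal_closure G S" by (auto simp: normal_closure_def)
qed

context
  fixes G :: "('a, 'c) monoid_scheme" and H :: "('b, 'd) monoid_scheme"
  assumes G: "group G" and H: "group H"
begin

interpretation G: group G by (rule G)
interpretation H: group H by (rule H)

lemma fp_cong_words:
  "(v, w) \<in> fp_cong G H \<Longrightarrow> v \<in> fp_words G H \<and> w \<in> fp_words G H"
  by (induction rule: fp_cong.induct) auto

lemma fp_cong_context:
  assumes "(v, w) \<in> fp_cong G H" "a \<in> fp_words G H" "b \<in> fp_words G H"
  shows "(a @ v @ b, a @ w @ b) \<in> fp_cong G H"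
  using assms
proof (induction rule: fp_cong.induct)
  case (refl w) then show ?case by (intro fp_cong.refl) auto
next
  case (sym v w) then show ?case by (blast intro: fp_cong.sym)
next
  case (trans u v w) then show ?case by (blast intro: fp_cong.trans)
next
  case (one_left p q)
  then show ?case using fp_cong.one_left[of "a @ p" G H "q @ b"] by simp
next
  case (one_right p q)
  then show ?case using fp_cong.one_right[of "a @ p" G H "q @ b"] by simp
next
  case (mult_left p q x x')
  then show ?case using fp_cong.mult_left[of "a @ p" G H "q @ b" x x'] by simp
next
  case (mult_right p q y y')
  then show ?case using fp_cong.mult_right[of "a @ p" G H "q @ b" y y'] by simp
qed

lemma fp_cong_equiv: "equiv (fp_words G H) (fp_cong G H)"
  using fp_cong_words
  by (auto simp: equiv_def refl_on_def sym_def trans_def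
           intro: fp_cong.refl fp_cong.sym fp_cong.trans)

lemma fp_cong_append:
  assumes "(v, v') \<in> fp_cong G H" "(w, w') \<in> fp_cong G H"
  shows "(v @ w, v' @ w') \<in> fp_cong G H"
  using fp_cong_context[OF assms(1), of "[]" w] fp_cong_context[OF assms(2), of v' "[]"]
    fp_cong_words[OF assms(1)] fp_cong_words[OF assms(2)]
  by (auto intro: fp_cong.trans)

lemma free_product_mult_class:
  assumes "v \<in> fp_words G H" "w \<in> fp_words G H"
  shows "fp_cong G H `` {v} \<otimes>\<^bsub>free_product G H\<^esub> fp_cong G H `` {w} = fp_cong G H `` {v @ w}"
proof -
  have "congruent2 (fp_cong G H) (fp_cong G H) (\<lambda>v w. fp_cong G H `` {v @ w})"
    by (auto simp: congruent2_def intro!: equiv_class_eq[OF fp_cong_equiv] fp_cong_append)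
  from UN_equiv_class2[OF fp_cong_equiv fp_cong_equiv this assms]
  show ?thesis by (simp add: free_product_def)
qed

lemma free_product_carrierE:
  assumes "X \<in> carrier (free_product G H)"
  obtains w where "w \<in> fp_words G H" "X = fp_cong G H `` {w}"
  using assms that unfolding free_product_def by (auto elim!: quotientE)

lemma free_product_class_carrier:
  "w \<in> fp_words G H \<Longrightarrow> fp_cong G H `` {w} \<in> carrier (free_product G H)"
  by (auto simp: free_product_def intro: quotientI)

lemma free_product_one: "\<one>\<^bsub>free_product G H\<^esub> = fp_cong G H `` {[]}"
  by (simp add: free_product_def)

lemma fp_word_inverse:
  assumes "w \<in> fp_words G H"
  shows "\<exists>w' \<in> fp_words G H. (w' @ w, []) \<in> fp_cong G H"
  using assms
proof (induction w rule: list.induct)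
  case Nil
  then show ?case by (auto intro!: bexI[of _ "[]"] fp_cong.refl)
next
  case (Cons l w)
  then have w: "w \<in> fp_words G H" by simp
  with Cons.IH obtain w' where w': "w' \<in> fp_words G H" "(w' @ w, []) \<in> fp_cong G H" by blast
  have "\<exists>l' \<in> carrier G <+> carrier H. ([l', l], []) \<in> fp_cong G H"
  proof (cases l)
    case (Inl x)
    then have x: "x \<in> carrier G" using Cons.prems by auto
    show ?thesis
      using fp_cong.mult_left[of "[]" G H "[]" "inv\<^bsub>G\<^esub> x" x] fp_cong.one_left[of "[]" G H "[]"] x
      by (intro bexI[of _ "Inl (inv\<^bsub>G\<^esub> x)"]) (auto simp: Inl intro: fp_cong.trans)
  next
    case (Inr y)
    then have y: "y \<in> carrier H" using Cons.prems by auto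
    show ?thesis
      using fp_cong.mult_right[of "[]" G H "[]" "inv\<^bsub>H\<^esub> y" y] fp_cong.one_right[of "[]" G H "[]"] y
      by (intro bexI[of _ "Inr (inv\<^bsub>H\<^esub> y)"]) (auto simp: Inr intro: fp_cong.trans)
  qed
  then obtain l' where l': "l' \<in> carrier G <+> carrier H" "([l', l], []) \<in> fp_cong G H" by blast
  have "((w' @ [l']) @ l # w, w' @ w) \<in> fp_cong G H"
    using fp_cong_context[OF l'(2) w'(1) w] by simp
  then have "((w' @ [l']) @ l # w, []) \<in> fp_cong G H" using w'(2) by (rule fp_cong.trans)
  then show ?case using w'(1) l'(1) by (intro bexI[of _ "w' @ [l']"]) auto
qed

lemma free_product_group: "group (free_product G H)"
proof (rule groupI)
  show "\<one>\<^bsub>free_product G H\<^esub> \<in> carrier (free_product G H)"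
    by (simp add: free_product_one free_product_class_carrier)
next
  fix X Y assume "X \<in> carrier (free_product G H)" "Y \<in> carrier (free_product G H)"
  then show "X \<otimes>\<^bsub>free_product G H\<^esub> Y \<in> carrier (free_product G H)"
    by (elim free_product_carrierE) (simp add: free_product_mult_class free_product_class_carrier)
next
  fix X Y Z
  assume "X \<in> carrier (free_product G H)" "Y \<in> carrier (free_product G H)"
    "Z \<in> carrier (free_product G H)"
  then show "X \<otimes>\<^bsub>free_product G H\<^esub> Y \<otimes>\<^bsub>free_product G H\<^esub> Z =
      X \<otimes>\<^bsub>free_product G H\<^esub> (Y \<otimes>\<^bsub>free_product G H\<^esub> Z)"
    by (elim free_product_carrierE) (simp add: free_product_mult_class)
next
  fix X assume "X \<in> carrier (free_product G H)"
  then show "\<one>\<^bsub>free_product G H\<^esub> \<otimes>\<^bsub>free_product G H\<^esub> X = X"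
    by (elim free_product_carrierE) (simp add: free_product_mult_class free_product_one)
next
  fix X assume "X \<in> carrier (free_product G H)"
  then obtain w where w: "w \<in> fp_words G H" "X = fp_cong G H `` {w}"
    by (rule free_product_carrierE)
  from fp_word_inverse[OF w(1)] obtain w' where
    w': "w' \<in> fp_words G H" "(w' @ w, []) \<in> fp_cong G H" by blast
  have "fp_cong G H `` {w'} \<otimes>\<^bsub>free_product G H\<^esub> X = \<one>\<^bsub>free_product G H\<^esub>"
    using w w' by (simp add: free_product_mult_class free_product_one equiv_class_eq[OF fp_cong_equiv])
  then show "\<exists>Y\<in>carrier (free_product G H). Y \<otimes>\<^bsub>free_product G H\<^esub> X = \<one>\<^bsub>free_product G H\<^esub>"
    using free_product_class_carrier[OF w'(1)] by blast
qed

lemma fp_inl_hom: "fp_inl G H \<in> hom G (free_product G H)"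
proof (rule homI)
  fix x x' assume *: "x \<in> carrier G" "x' \<in> carrier G"
  then have "fp_cong G H `` {[Inl x, Inl x']} = fp_cong G H `` {[Inl (x \<otimes>\<^bsub>G\<^esub> x')]}"
    using fp_cong.mult_left[of "[]" G H "[]" x x'] by (intro equiv_class_eq[OF fp_cong_equiv]) auto
  with * show "fp_inl G H (x \<otimes>\<^bsub>G\<^esub> x') = fp_inl G H x \<otimes>\<^bsub>free_product G H\<^esub> fp_inl G H x'"
    by (subst (2 3) fp_inl_def, subst free_product_mult_class) (auto simp: fp_inl_def)
qed (auto simp: fp_inl_def intro!: free_product_class_carrier)

lemma fp_inr_hom: "fp_inr G H \<in> hom H (free_product G H)"
proof (rule homI)
  fix y y' assume *: "y \<in> carrier H" "y' \<in> carrier H"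
  then have "fp_cong G H `` {[Inr y, Inr y']} = fp_cong G H `` {[Inr (y \<otimes>\<^bsub>H\<^esub> y')]}"
    using fp_cong.mult_right[of "[]" G H "[]" y y'] by (intro equiv_class_eq[OF fp_cong_equiv]) auto
  with * show "fp_inr G H (y \<otimes>\<^bsub>H\<^esub> y') = fp_inr G H y \<otimes>\<^bsub>free_product G H\<^esub> fp_inr G H y'"
    by (subst (2 3) fp_inr_def, subst free_product_mult_class) (auto simp: fp_inr_def)
qed (auto simp: fp_inr_def intro!: free_product_class_carrier)

end

context
  fixes B :: "('a, 'c) monoid_scheme" and \<theta> :: "'a \<Rightarrow> 'a"
  assumes B: "group B" and \<theta>: "\<theta> \<in> hom B B"
begin

interpretation F: group "free_product B integer_group"
  by (simp add: free_product_group B)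

lemma hnn_generators_closed:
  shows "b \<in> carrier B \<Longrightarrow> fp_inl B integer_group b \<in> carrier (free_product B integer_group)"
    and "fp_inr B integer_group n \<in> carrier (free_product B integer_group)"
  using fp_inl_hom[OF B group_integer_group] fp_inr_hom[OF B group_integer_group]
  by (auto simp: hom_def)

lemma hnn_relators_closed: "hnn_relators B \<theta> \<subseteq> carrier (free_product B integer_group)"
  using hnn_generators_closed \<theta> by (auto simp: hnn_relators_def Let_def hom_def Pi_iff)

lemma hnn_normal:
  "normal_closure (free_product B integer_group) (hnn_relators B \<theta>) \<lhd> free_product B integer_group"
  by (rule normal_closure_normal(1)[OF F.group_axioms hnn_relators_closed])

lemma asc_hnn_group: "group (asc_hnn B \<theta>)"
  unfolding asc_hnn_def by (rule normal.factorgroup_is_group[OF hnn_normal])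

lemma hnn_base_hom: "hnn_base B \<theta> \<in> hom B (asc_hnn B \<theta>)"
proof -
  have "(\<lambda>a. normal_closure (free_product B integer_group) (hnn_relators B \<theta>)
      #>\<^bsub>free_product B integer_group\<^esub> a) \<circ> fp_inl B integer_group \<in> hom B (asc_hnn B \<theta>)"
    unfolding asc_hnn_def
    by (rule hom_compose[OF fp_inl_hom[OF B group_integer_group] normal.r_coset_hom_Mod[OF hnn_normal]])
  then show ?thesis by (simp add: hnn_base_def[abs_def] comp_def)
qed

lemma hnn_stable_closed: "hnn_stable B \<theta> \<in> carrier (asc_hnn B \<theta>)"
  using hnn_generators_closed(2)
  by (auto simp: hnn_stable_def asc_hnn_def carrier_FactGroup)

lemma asc_hnn_relation:
  assumes b: "b \<in> carrier B"
  shows "hnn_stable B \<theta> \<otimes>\<^bsub>asc_hnn B \<theta>\<^esub> hnn_base B \<theta> b \<otimes>\<^bsub>asc_hnn B \<theta>\<^esub>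
           inv\<^bsub>asc_hnn B \<theta>\<^esub> (hnn_stable B \<theta>) = hnn_base B \<theta> (\<theta> b)"
proof -
  let ?F = "free_product B integer_group" and ?G = "asc_hnn B \<theta>"
  let ?N = "normal_closure ?F (hnn_relators B \<theta>)"
  let ?p = "\<lambda>a. ?N #>\<^bsub>?F\<^esub> a"
  let ?t = "fp_inr B integer_group 1" and ?i = "fp_inl B integer_group"
  interpret N: normal ?N ?F by (rule hnn_normal)
  interpret G: group ?G by (rule asc_hnn_group)
  interpret p: group_hom ?F ?G ?p
    by unfold_locales (simp add: asc_hnn_def N.r_coset_hom_Mod)
  have \<theta>b: "\<theta> b \<in> carrier B" using \<theta> b by (auto simp: hom_def)
  note cl = hnn_generators_closed(1)[OF b] hnn_generators_closed(1)[OF \<theta>b] hnn_generators_closed(2)[of 1]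
  let ?r = "?t \<otimes>\<^bsub>?F\<^esub> ?i b \<otimes>\<^bsub>?F\<^esub> inv\<^bsub>?F\<^esub> ?t \<otimes>\<^bsub>?F\<^esub> inv\<^bsub>?F\<^esub> (?i (\<theta> b))"
  have "?r \<in> hnn_relators B \<theta>" using b by (auto simp: hnn_relators_def Let_def)
  then have "?r \<in> ?N"
    using normal_closure_normal(2)[OF F.group_axioms hnn_relators_closed] by blast
  then have "?p ?r = \<one>\<^bsub>?G\<^esub>"
    using F.coset_join2[OF _ N.subgroup_axioms] cl by (simp add: asc_hnn_def)
  then have "?p ?t \<otimes>\<^bsub>?G\<^esub> ?p (?i b) \<otimes>\<^bsub>?G\<^esub> inv\<^bsub>?G\<^esub> (?p ?t) \<otimes>\<^bsub>?G\<^esub> inv\<^bsub>?G\<^esub> (?p (?i (\<theta> b))) = \<one>\<^bsub>?G\<^esub>"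
    using cl by simp
  then have "?p ?t \<otimes>\<^bsub>?G\<^esub> ?p (?i b) \<otimes>\<^bsub>?G\<^esub> inv\<^bsub>?G\<^esub> (?p ?t) = ?p (?i (\<theta> b))"
    using cl p.hom_closed G.inv_solve_right' G.r_one G.l_one by (metis G.inv_closed G.m_closed G.one_closed)
  then show ?thesis by (simp add: hnn_stable_def hnn_base_def)
qed

end

lemma zz_endomorphism_exists:
  "\<exists>\<theta> \<in> hom ZZ ZZ.
     \<theta> zz_u = zz_u [^]\<^bsub>ZZ\<^esub> (5::nat) \<otimes>\<^bsub>ZZ\<^esub> inv\<^bsub>ZZ\<^esub> zz_v \<and> \<theta> zz_v = zz_u [^]\<^bsub>ZZ\<^esub> (2::nat)"
proof -
  have pow: "(a, b) [^]\<^bsub>ZZ\<^esub> (n::nat) = (int n * a, int n * b)" for a b n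
    by (induction n) (auto simp: nat_pow_def algebra_simps)
  have "(\<lambda>(a, b). (5 * a + 2 * b, - a)) \<in> hom ZZ ZZ"
    by (auto simp: hom_def)
  then show ?thesis
    by (rule bexI[rotated]) (simp add: pow inv_DirProd)
qed

end

theory Submission
  imports Defs "HOL-Computational_Algebra.Polynomial"
begin

text \<open>The matrix of \<open>\<theta>\<close> has characteristic polynomial \<open>x\<^sup>2 - 5 x + 2\<close>, whose larger root
  \<open>\<lambda> = (5 + sqrt 17) / 2\<close> has no rational power except \<open>\<lambda>\<^sup>0\<close>. Sending \<open>u\<close> and \<open>v\<close> to the
  translations by \<open>\<lambda>\<close> and \<open>2\<close>, and \<open>t\<close> to multiplication by \<open>\<lambda>\<close>, embeds \<open>G\<close> in the affine group
  of the real line, because every element of \<open>G\<close> has the form \<open>t\<^sup>-\<^sup>n b t\<^sup>k\<close>. The affine group is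
  metabelian, so \<open>G\<close> is soluble. If \<open>s c s\<inverse> = c\<^sup>m\<close>, then either \<open>m = 1\<close> or \<open>c\<close> is a translation
  and the power of \<open>\<lambda>\<close> by which \<open>s\<close> scales it is the integer \<open>m\<close>, hence \<open>1\<close>; so no cyclic
  subgroup is conjugated into itself strictly. Finally, a finite index subgroup that
  contains \<open>t B t\<inverse>\<close> contains \<open>B\<close>, so \<open>t B t\<inverse>\<close> is not an intersection of finite index subgroups
  when it is a proper subgroup of \<open>B\<close>.\<close>

section \<open>Universal properties and the normal form\<close>

text \<open>Evaluating a word letter by letter in \<open>K\<close> gives equal values on both sides
  of every generating pair of the congruence, so the evaluation descends to classes.\<close>

lemma free_product_universal:
  assumes G: "group G" and H: "group H" and K: "group K"
    and f: "f \<in> hom G K" and h: "h \<in> hom H K"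
  obtains \<phi> where "\<phi> \<in> hom (free_product G H) K"
    and "\<And>x. x \<in> carrier G \<Longrightarrow> \<phi> (fp_inl G H x) = f x"
    and "\<And>y. y \<in> carrier H \<Longrightarrow> \<phi> (fp_inr G H y) = h y"
proof -
  interpret K: group K by (rule K)
  interpret f: group_hom G K f using G K f by (simp add: group_hom_def group_hom_axioms_def)
  interpret h: group_hom H K h using H K h by (simp add: group_hom_def group_hom_axioms_def)
  define ev where "ev = (\<lambda>w. foldr (\<lambda>l y. case_sum f h l \<otimes>\<^bsub>K\<^esub> y) w \<one>\<^bsub>K\<^esub>)"
  have ev_simps [simp]: "ev [] = \<one>\<^bsub>K\<^esub>" "ev (l # w) = case_sum f h l \<otimes>\<^bsub>K\<^esub> ev w" for l w
    by (simp_all add: ev_def)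
  have letter [simp]: "case_sum f h l \<in> carrier K" if "l \<in> carrier G <+> carrier H" for l
    using that by auto
  have ev_closed [simp]: "ev w \<in> carrier K" if "\<forall>l\<in>set w. l \<in> carrier G <+> carrier H" for w
    using that by (induction w) auto
  have ev_append: "ev (v @ w) = ev v \<otimes>\<^bsub>K\<^esub> ev w"
    if "\<forall>l\<in>set v. l \<in> carrier G <+> carrier H" "\<forall>l\<in>set w. l \<in> carrier G <+> carrier H" for v w
    using that by (induction v) (auto simp: K.m_assoc)
  have ev_closed' [simp]: "ev w \<in> carrier K" if "w \<in> fp_words G H" for w
    by (rule ev_closed) (use that in auto)
  have ev_append': "ev (v @ w) = ev v \<otimes>\<^bsub>K\<^esub> ev w" if "v \<in> fp_words G H" "w \<in> fp_words G H" for v w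
    by (rule ev_append) (use that in auto)
  have ev_cong: "(v, w) \<in> fp_cong G H \<Longrightarrow> ev v = ev w" for v w
    by (induction rule: fp_cong.induct) (auto simp: ev_append K.m_assoc InlI InrI)
  \<comment> \<open>Since \<open>ev\<close> is constant on a class, its image of the class is a
    singleton, and \<open>the_elem\<close> reads off the common value.\<close>
  define \<phi> where "\<phi> = (\<lambda>X. the_elem (ev ` X))"
  have \<phi>: "\<phi> (fp_cong G H `` {w}) = ev w" if "w \<in> fp_words G H" for w
  proof -
    have "ev v = ev w" if "v \<in> fp_cong G H `` {w}" for v
      using that by (metis ImageE ev_cong singletonD)
    moreover have "w \<in> fp_cong G H `` {w}" using fp_cong.refl[OF that] by simp
    ultimately have "ev ` (fp_cong G H `` {w}) = {ev w}" by blast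
    then show ?thesis by (simp add: \<phi>_def)
  qed
  show thesis
  proof
    show "\<phi> \<in> hom (free_product G H) K"
    proof (rule homI)
      fix X assume "X \<in> carrier (free_product G H)"
      then show "\<phi> X \<in> carrier K"
        by (elim free_product_carrierE[OF G H]) (simp add: \<phi>)
    next
      fix X Y assume "X \<in> carrier (free_product G H)" "Y \<in> carrier (free_product G H)"
      then show "\<phi> (X \<otimes>\<^bsub>free_product G H\<^esub> Y) = \<phi> X \<otimes>\<^bsub>K\<^esub> \<phi> Y"
        by (elim free_product_carrierE[OF G H])
          (simp add: \<phi> free_product_mult_class[OF G H] ev_append')
    qed
    show "\<phi> (fp_inl G H x) = f x" if "x \<in> carrier G" for x
      using \<phi>[of "[Inl x]"] that by (simp add: fp_inl_def InlI)
    show "\<phi> (fp_inr G H y) = h y" if "y \<in> carrier H" for y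
      using \<phi>[of "[Inr y]"] that by (simp add: fp_inr_def InrI)
  qed
qed

text \<open>This is the source of the homomorphism into the affine group. By \<open>rel\<close> the
  map induced on the free product kills every relator; its kernel is normal, hence contains the
  normal closure, and the map factors through the quotient.\<close>

lemma asc_hnn_universal:
  assumes B: "group B" and \<theta>: "\<theta> \<in> hom B B" and K: "group K"
    and f: "f \<in> hom B K" and s: "s \<in> carrier K"
    and rel: "\<And>b. b \<in> carrier B \<Longrightarrow> s \<otimes>\<^bsub>K\<^esub> f b \<otimes>\<^bsub>K\<^esub> inv\<^bsub>K\<^esub> s = f (\<theta> b)"
  obtains \<phi> where "\<phi> \<in> hom (asc_hnn B \<theta>) K"
    and "\<And>b. b \<in> carrier B \<Longrightarrow> \<phi> (hnn_base B \<theta> b) = f b"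
    and "\<phi> (hnn_stable B \<theta>) = s"
proof -
  let ?F = "free_product B integer_group"
  let ?N = "normal_closure ?F (hnn_relators B \<theta>)"
  interpret F: group ?F by (simp add: free_product_group B)
  interpret K: group K by (rule K)
  interpret N: normal ?N ?F by (rule hnn_normal[OF B \<theta>])
  obtain \<psi> where \<psi>: "\<psi> \<in> hom ?F K"
    and inl: "\<And>b. b \<in> carrier B \<Longrightarrow> \<psi> (fp_inl B integer_group b) = f b"
    and inr: "\<And>k. k \<in> carrier integer_group \<Longrightarrow> \<psi> (fp_inr B integer_group k) = s [^]\<^bsub>K\<^esub> k"
    using free_product_universal[OF B group_integer_group K f K.hom_integer_group_pow[OF s]] by blast
  interpret \<psi>: group_hom ?F K \<psi>
    using \<psi> by (simp add: group_hom_def group_hom_axioms_def F.group_axioms K)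
  note cl [simp] = hnn_generators_closed[OF B \<theta>]
  have \<theta>_closed: "\<theta> b \<in> carrier B" if "b \<in> carrier B" for b
    using \<theta> that by (auto simp: hom_def)
  have f_closed [simp]: "f b \<in> carrier K" if "b \<in> carrier B" for b
    using f that by (auto simp: hom_def)
  have "hnn_relators B \<theta> \<subseteq> kernel ?F K \<psi>"
    by (auto simp: hnn_relators_def Let_def kernel_def inl inr s \<theta>_closed rel)
  then have N_kernel: "?N \<subseteq> kernel ?F K \<psi>"
    using \<psi>.normal_kernel by (auto simp: normal_closure_def)
  \<comment> \<open>Two elements of one coset of the normal closure differ by a factor in the
    kernel.\<close>
  have "\<psi> x = \<psi> y" if "x \<in> carrier ?F" "y \<in> carrier ?F" "?N #>\<^bsub>?F\<^esub> x = ?N #>\<^bsub>?F\<^esub> y" for x y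
  proof -
    have "y \<in> ?N #>\<^bsub>?F\<^esub> x"
      using F.repr_independenceD[OF N.subgroup_axioms that(2,3)] .
    then show ?thesis
      using N_kernel that(1) by (auto simp: r_coset_def kernel_def)
  qed
  then obtain \<phi> where \<phi>: "\<phi> \<in> hom (?F Mod ?N) K"
    "\<And>x. x \<in> carrier ?F \<Longrightarrow> \<phi> (?N #>\<^bsub>?F\<^esub> x) = \<psi> x"
    using FactGroup_universal[OF \<psi> hnn_normal[OF B \<theta>]] by metis
  show thesis
  proof
    show "\<phi> \<in> hom (asc_hnn B \<theta>) K" using \<phi>(1) by (simp add: asc_hnn_def)
    show "\<phi> (hnn_base B \<theta> b) = f b" if "b \<in> carrier B" for b
      using \<phi>(2)[OF cl(1)[OF that]] inl[OF that] by (simp add: hnn_base_def)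
    show "\<phi> (hnn_stable B \<theta>) = s"
      using \<phi>(2)[OF cl(2)] inr[of 1] s by (simp add: hnn_stable_def)
  qed
qed

section \<open>Moving the stable letter past the base, and the normal form\<close>

lemma asc_hnn_stable_power_base:
  assumes B: "group B" and \<theta>: "\<theta> \<in> hom B B" and b: "b \<in> carrier B"
  shows "hnn_stable B \<theta> [^]\<^bsub>asc_hnn B \<theta>\<^esub> (n::nat) \<otimes>\<^bsub>asc_hnn B \<theta>\<^esub> hnn_base B \<theta> b =
    hnn_base B \<theta> ((\<theta> ^^ n) b) \<otimes>\<^bsub>asc_hnn B \<theta>\<^esub> hnn_stable B \<theta> [^]\<^bsub>asc_hnn B \<theta>\<^esub> n"
proof (induction n)
  let ?G = "asc_hnn B \<theta>" and ?t = "hnn_stable B \<theta>" and ?i = "hnn_base B \<theta>"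
  interpret G: group ?G by (rule asc_hnn_group[OF B \<theta>])
  have t [simp]: "?t \<in> carrier ?G" by (rule hnn_stable_closed[OF B \<theta>])
  have i [simp]: "?i c \<in> carrier ?G" if "c \<in> carrier B" for c
    using hnn_base_hom[OF B \<theta>] that by (auto simp: hom_def)
  have \<theta>_closed [simp]: "(\<theta> ^^ n) b \<in> carrier B" for n
    using \<theta> b by (induction n) (auto simp: hom_def)
  {
    case 0
    show ?case using b by simp
  next
    case (Suc n)
    have rel: "?t \<otimes>\<^bsub>?G\<^esub> ?i c = ?i (\<theta> c) \<otimes>\<^bsub>?G\<^esub> ?t" if "c \<in> carrier B" "\<theta> c \<in> carrier B" for c
      using asc_hnn_relation[OF B \<theta> that(1)] that by (metis G.inv_solve_right' G.m_closed i t)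
    have "?t [^]\<^bsub>?G\<^esub> Suc n \<otimes>\<^bsub>?G\<^esub> ?i b = ?t \<otimes>\<^bsub>?G\<^esub> (?t [^]\<^bsub>?G\<^esub> n \<otimes>\<^bsub>?G\<^esub> ?i b)"
      using b by (subst G.nat_pow_Suc2) (simp_all add: G.m_assoc)
    also have "\<dots> = (?t \<otimes>\<^bsub>?G\<^esub> ?i ((\<theta> ^^ n) b)) \<otimes>\<^bsub>?G\<^esub> ?t [^]\<^bsub>?G\<^esub> n"
      by (simp add: Suc G.m_assoc)
    also have "\<dots> = ?i ((\<theta> ^^ Suc n) b) \<otimes>\<^bsub>?G\<^esub> (?t \<otimes>\<^bsub>?G\<^esub> ?t [^]\<^bsub>?G\<^esub> n)"
      using \<theta>_closed[of n] \<theta>_closed[of "Suc n"] by (simp add: rel G.m_assoc del: \<theta>_closed)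
    finally show ?case by (subst G.nat_pow_Suc2) simp_all
  }
qed

text \<open>The products \<open>t^(-n) b t^k\<close> include the identity and are closed under right
  multiplication by base elements and by powers of \<open>t\<close>. Every element is a product of
  such letters.\<close>

lemma asc_hnn_normal_form:
  assumes B: "group B" and \<theta>: "\<theta> \<in> hom B B" and g: "g \<in> carrier (asc_hnn B \<theta>)"
  obtains n :: nat and b and k :: int
  where "b \<in> carrier B"
    and "g = inv\<^bsub>asc_hnn B \<theta>\<^esub> (hnn_stable B \<theta> [^]\<^bsub>asc_hnn B \<theta>\<^esub> n) \<otimes>\<^bsub>asc_hnn B \<theta>\<^esub>
      hnn_base B \<theta> b \<otimes>\<^bsub>asc_hnn B \<theta>\<^esub> hnn_stable B \<theta> [^]\<^bsub>asc_hnn B \<theta>\<^esub> k"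
proof -
  let ?F = "free_product B integer_group" and ?G = "asc_hnn B \<theta>"
  let ?N = "normal_closure ?F (hnn_relators B \<theta>)"
  let ?p = "\<lambda>a. ?N #>\<^bsub>?F\<^esub> a" and ?t = "hnn_stable B \<theta>" and ?i = "hnn_base B \<theta>"
  define nf where "nf = (\<lambda>n b k. inv\<^bsub>?G\<^esub> (?t [^]\<^bsub>?G\<^esub> (n::nat)) \<otimes>\<^bsub>?G\<^esub> ?i b \<otimes>\<^bsub>?G\<^esub> ?t [^]\<^bsub>?G\<^esub> (k::int))"
  interpret B: group B by (rule B)
  interpret F: group ?F by (simp add: free_product_group B)
  interpret G: group ?G by (rule asc_hnn_group[OF B \<theta>])
  interpret N: normal ?N ?F by (rule hnn_normal[OF B \<theta>])
  interpret p: group_hom ?F ?G ?p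
    by unfold_locales (simp add: asc_hnn_def N.r_coset_hom_Mod)
  interpret i: group_hom B ?G ?i
    using hnn_base_hom[OF B \<theta>] by unfold_locales
  have t [simp]: "?t \<in> carrier ?G" by (rule hnn_stable_closed[OF B \<theta>])
  have \<theta>_closed [simp]: "(\<theta> ^^ n) b \<in> carrier B" if "b \<in> carrier B" for n b
    using \<theta> that by (induction n) (auto simp: hom_def)
  note push = asc_hnn_stable_power_base[OF B \<theta>]
  \<comment> \<open>For \<open>k = m \<ge> 0\<close>, moving \<open>t^m\<close> to the right past
    \<open>c\<close> turns \<open>c\<close> into \<open>\<theta>^m(c)\<close>, which is merged with
    \<open>b\<close>. For \<open>k = -m < 0\<close>, the relation reads
    \<open>b t^(-m) = t^(-m) \<theta>^m(b)\<close>, so \<open>m\<close> is added to \<open>n\<close>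
    and the right exponent becomes 0.\<close>
  have nf_base: "\<exists>n' b' k'. b' \<in> carrier B \<and> nf n b k \<otimes>\<^bsub>?G\<^esub> ?i c = nf n' b' k'"
    if b: "b \<in> carrier B" and c: "c \<in> carrier B" for n b k c
  proof (cases "k \<ge> 0")
    case True
    then obtain m where k: "k = int m" using nonneg_int_cases by blast
    have "nf n b k \<otimes>\<^bsub>?G\<^esub> ?i c =
        inv\<^bsub>?G\<^esub> (?t [^]\<^bsub>?G\<^esub> n) \<otimes>\<^bsub>?G\<^esub> ?i b \<otimes>\<^bsub>?G\<^esub> (?t [^]\<^bsub>?G\<^esub> m \<otimes>\<^bsub>?G\<^esub> ?i c)"
      using b c by (simp add: nf_def k int_pow_int G.m_assoc)
    also have "\<dots> = nf n (b \<otimes>\<^bsub>B\<^esub> (\<theta> ^^ m) c) k"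
      using b c by (simp add: push nf_def k int_pow_int G.m_assoc)
    finally show ?thesis using b c by (metis B.m_closed \<theta>_closed)
  next
    case False
    then obtain m where k: "k = - int m" by (metis linear minus_minus neg_0_le_iff_le nonneg_int_cases)
    let ?T = "?t [^]\<^bsub>?G\<^esub> m"
    have "?i b = inv\<^bsub>?G\<^esub> ?T \<otimes>\<^bsub>?G\<^esub> (?i ((\<theta> ^^ m) b) \<otimes>\<^bsub>?G\<^esub> ?T)"
      using b by (subst G.inv_solve_left) (simp_all add: push)
    then have "?i b \<otimes>\<^bsub>?G\<^esub> inv\<^bsub>?G\<^esub> ?T = inv\<^bsub>?G\<^esub> ?T \<otimes>\<^bsub>?G\<^esub> ?i ((\<theta> ^^ m) b)"
      using b by (simp add: G.m_assoc)
    then have "nf n b k \<otimes>\<^bsub>?G\<^esub> ?i c =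
        inv\<^bsub>?G\<^esub> (?t [^]\<^bsub>?G\<^esub> n) \<otimes>\<^bsub>?G\<^esub> (inv\<^bsub>?G\<^esub> ?T \<otimes>\<^bsub>?G\<^esub> ?i ((\<theta> ^^ m) b)) \<otimes>\<^bsub>?G\<^esub> ?i c"
      using b c by (simp add: nf_def k G.int_pow_neg_int G.m_assoc)
    also have "\<dots> = inv\<^bsub>?G\<^esub> (?T \<otimes>\<^bsub>?G\<^esub> ?t [^]\<^bsub>?G\<^esub> n) \<otimes>\<^bsub>?G\<^esub> ?i ((\<theta> ^^ m) b \<otimes>\<^bsub>B\<^esub> c)"
      using b c by (simp add: G.inv_mult_group G.m_assoc)
    also have "\<dots> = nf (m + n) ((\<theta> ^^ m) b \<otimes>\<^bsub>B\<^esub> c) 0"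
      using b c by (simp add: nf_def G.nat_pow_mult)
    finally show ?thesis using b c by (metis B.m_closed \<theta>_closed)
  qed
  \<comment> \<open>In the additive group of integers \<open>k\<close> is the \<open>k\<close>-th
    power of the generator 1, which maps to the stable letter.\<close>
  have stable_power: "?p (fp_inr B integer_group k) = ?t [^]\<^bsub>?G\<^esub> k" for k
  proof -
    have "fp_inr B integer_group (1 [^]\<^bsub>integer_group\<^esub> k) = fp_inr B integer_group 1 [^]\<^bsub>?F\<^esub> k"
      by (rule hom_int_pow[OF fp_inr_hom[OF B group_integer_group]]) (simp_all add: F.group_axioms)
    then show ?thesis
      by (simp add: hnn_stable_def p.hom_int_pow hnn_generators_closed[OF B \<theta>])
  qed
  have "\<exists>n b k. b \<in> carrier B \<and> ?p (fp_cong B integer_group `` {w}) = nf n b k"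
    if "w \<in> fp_words B integer_group" for w
    using that
  \<comment> \<open>Letters are appended at the right end, matching closure under right
    multiplication.\<close>
  proof (induction w rule: rev_induct)
    case Nil
    have "?p (fp_cong B integer_group `` {[]}) = \<one>\<^bsub>?G\<^esub>"
      using p.hom_one free_product_one[OF B group_integer_group] by simp
    also have "\<dots> = nf 0 \<one>\<^bsub>B\<^esub> 0" by (simp add: nf_def)
    finally show ?case by blast
  next
    case (snoc l w)
    then obtain n b k where b: "b \<in> carrier B"
      and w: "?p (fp_cong B integer_group `` {w}) = nf n b k" by auto
    have "?p (fp_cong B integer_group `` {w @ [l]}) =
        nf n b k \<otimes>\<^bsub>?G\<^esub> ?p (fp_cong B integer_group `` {[l]})"
      using snoc.prems
      by (simp add: free_product_mult_class[OF B group_integer_group, symmetric] w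
          free_product_class_carrier[OF B group_integer_group])
    moreover have "\<exists>n' b' k'. b' \<in> carrier B \<and>
        nf n b k \<otimes>\<^bsub>?G\<^esub> ?p (fp_cong B integer_group `` {[l]}) = nf n' b' k'"
    proof (cases l)
      case (Inl c)
      then have "c \<in> carrier B" using snoc.prems by auto
      then show ?thesis using nf_base[OF b] Inl by (simp add: hnn_base_def fp_inl_def)
    next
      case (Inr j)
      then have "?p (fp_cong B integer_group `` {[l]}) = ?t [^]\<^bsub>?G\<^esub> j"
        using stable_power by (simp add: fp_inr_def)
      then have "nf n b k \<otimes>\<^bsub>?G\<^esub> ?p (fp_cong B integer_group `` {[l]}) = nf n b (k + j)"
        using b by (simp add: nf_def G.m_assoc G.int_pow_mult)
      with b show ?thesis by blast
    qed
    ultimately show ?case by simp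
  qed
  moreover obtain X where "X \<in> carrier ?F" "g = ?p X"
    using g by (auto simp: asc_hnn_def carrier_FactGroup)
  then obtain w where "w \<in> fp_words B integer_group" "g = ?p (fp_cong B integer_group `` {w})"
    by (blast elim: free_product_carrierE[OF B group_integer_group])
  ultimately show thesis using that unfolding nf_def by metis
qed

section \<open>Failure of LERF\<close>

lemma (in group) inv_cancel_left:
  assumes "x \<in> carrier G" "y \<in> carrier G"
  shows "inv x \<otimes> (x \<otimes> y) = y" "x \<otimes> (inv x \<otimes> y) = y"
  using assms by (simp_all add: m_assoc[symmetric])

lemma (in group) conjugation_hom:
  assumes "t \<in> carrier G"
  shows "(\<lambda>x. t \<otimes> x \<otimes> inv t) \<in> hom G G"
proof (rule homI)
  fix x y assume "x \<in> carrier G" "y \<in> carrier G"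
  then show "t \<otimes> (x \<otimes> y) \<otimes> inv t = t \<otimes> x \<otimes> inv t \<otimes> (t \<otimes> y \<otimes> inv t)"
    using assms by (simp add: m_assoc inv_cancel_left)
qed (use assms in auto)

text \<open>By the pigeonhole principle, some power \<open>T\<close> of \<open>t\<close> fixes the cosets \<open>K b\<close> and \<open>K\<close>, so that
  \<open>T\<close> and \<open>b T b\<inverse>\<close> lie in \<open>K\<close>; then so does \<open>b = (b T b\<inverse>) T\<inverse> (T b T\<inverse>)\<close>.\<close>

lemma (in group) finite_index_contains_base:
  assumes t: "t \<in> carrier G" and B: "subgroup B G"
    and conj: "(\<lambda>b. t \<otimes> b \<otimes> inv t) ` B \<subseteq> B"
    and K: "subgroup K G" and fin: "finite (rcosets K)"
    and sub: "(\<lambda>b. t \<otimes> b \<otimes> inv t) ` B \<subseteq> K"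
  shows "B \<subseteq> K"
proof
  fix b assume "b \<in> B"
  then have b [simp]: "b \<in> carrier G" using subgroup.mem_carrier[OF B] by blast
  note t [simp]
  interpret K: subgroup K G by (rule K)
  \<comment> \<open>The exponent starts at 1: for exponent 0 the conjugate is \<open>c\<close>
    itself, whose membership in \<open>K\<close> is the claim being proved.\<close>
  have iter: "t [^] Suc n \<otimes> c \<otimes> inv (t [^] Suc n) \<in> B \<inter> K" if "c \<in> B" for c and n :: nat
  proof (induction n)
    case 0
    then show ?case using that conj sub by auto
  next
    case (Suc n)
    have [simp]: "c \<in> carrier G" using subgroup.mem_carrier[OF B that] .
    have "t [^] Suc (Suc n) \<otimes> c \<otimes> inv (t [^] Suc (Suc n)) =
        t \<otimes> (t [^] Suc n \<otimes> c \<otimes> inv (t [^] Suc n)) \<otimes> inv t"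
      by (subst (1 2) nat_pow_Suc2) (simp_all add: inv_mult_group m_assoc del: nat_pow_Suc)
    then show ?case using Suc conj sub by auto
  qed
  \<comment> \<open>Inverse powers appear because the cosets are right cosets:
    \<open>P i = P j\<close> puts \<open>t^(j-i)\<close> and its conjugate by \<open>b\<close> into
    \<open>K\<close>.\<close>
  define P where "P = (\<lambda>n::nat. (K #> (b \<otimes> inv (t [^] n)), K #> inv (t [^] n)))"
  have "range P \<subseteq> (rcosets K) \<times> (rcosets K)"
    by (auto simp: P_def intro!: rcosetsI K.subset)
  then have "finite (range P)" using fin by (meson finite_SigmaI finite_subset)
  then have "\<not> inj P" using finite_imageD infinite_UNIV_nat by blast
  then obtain i j where "i < j" and P: "P i = P j"
    by (metis injI linorder_neqE_nat)
  \<comment> \<open>Writing the difference as \<open>Suc n\<close> makes \<open>T\<close> a positive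
    power, to which \<open>iter\<close> applies.\<close>
  then obtain n where j: "j = Suc n + i" using less_imp_Suc_add by (metis add.commute add_Suc)
  define T where "T = t [^] Suc n"
  have [simp]: "T \<in> carrier G" unfolding T_def by simp
  have Tij: "t [^] j = t [^] i \<otimes> T" unfolding T_def by (simp only: j nat_pow_mult t add.commute)
  have "b \<otimes> inv (t [^] i) \<otimes> inv (b \<otimes> inv (t [^] j)) \<in> K"
    using P by (intro coset_join1[OF coset_mult_inv2 _ K]) (auto simp: P_def K.subset)
  moreover have "b \<otimes> inv (t [^] i) \<otimes> inv (b \<otimes> inv (t [^] j)) = b \<otimes> T \<otimes> inv b"
    unfolding Tij by (simp add: inv_mult_group m_assoc inv_cancel_left)
  ultimately have 1: "b \<otimes> T \<otimes> inv b \<in> K" by simp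
  have "inv (t [^] i) \<otimes> inv (inv (t [^] j)) \<in> K"
    using P by (intro coset_join1[OF coset_mult_inv2 _ K]) (auto simp: P_def K.subset)
  moreover have "inv (t [^] i) \<otimes> inv (inv (t [^] j)) = T"
    by (simp add: Tij inv_cancel_left)
  ultimately have 2: "T \<in> K" by simp
  have 3: "T \<otimes> b \<otimes> inv T \<in> K" unfolding T_def using iter[OF \<open>b \<in> B\<close>] by blast
  have "b = (b \<otimes> T \<otimes> inv b) \<otimes> inv T \<otimes> (T \<otimes> b \<otimes> inv T)"
    by (simp add: m_assoc inv_cancel_left)
  then show "b \<in> K" using 1 2 3 by (metis K.m_closed K.m_inv_closed)
qed

text \<open>The subgroup that violates the LERF condition is the conjugate of
  \<open>generate G S\<close>. It is finitely generated, by the conjugates of \<open>S\<close>, yet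
  every finite index subgroup above it contains all of \<open>generate G S\<close>.\<close>

lemma (in group) strictly_ascending_not_LERF:
  assumes t: "t \<in> carrier G" and S: "finite S" "S \<subseteq> carrier G"
    and strict: "(\<lambda>b. t \<otimes> b \<otimes> inv t) ` generate G S \<subset> generate G S"
  shows "\<not> LERF G"
proof
  let ?c = "\<lambda>b. t \<otimes> b \<otimes> inv t"
  interpret c: group_hom G G ?c
    using conjugation_hom[OF t] by unfold_locales
  assume LERF: "LERF G"
  have "finite (?c ` S) \<and> ?c ` S \<subseteq> carrier G"
    using S c.hom_closed by blast
  from LERF[unfolded LERF_def, rule_format, OF this]
  obtain \<K> where K: "\<forall>K\<in>\<K>. subgroup K G \<and> finite (rcosets K)"
    and eq: "generate G (?c ` S) = \<Inter> \<K>"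
    by (elim exE conjE)
  have img: "generate G (?c ` S) = ?c ` generate G S"
    by (rule c.generate_img[OF S(2)])
  have "generate G S \<subseteq> K" if "K \<in> \<K>" for K
  proof (rule finite_index_contains_base[OF t generate_is_subgroup[OF S(2)]])
    show "?c ` generate G S \<subseteq> K" using that unfolding img[symmetric] eq by (rule Inter_lower)
    show "?c ` generate G S \<subseteq> generate G S" using strict by (rule psubset_imp_subset)
    show "subgroup K G" "finite (rcosets K)" using K that by blast+
  qed
  then have "generate G S \<subseteq> ?c ` generate G S"
    unfolding img[symmetric] eq by (rule Inter_greatest)
  with strict show False by simp
qed

section \<open>The affine group of a field\<close>

text \<open>The pair \<open>(x, a)\<close> stands for the map \<open>z \<mapsto> x + a * z\<close>,
  and multiplication is composition of maps. Thus \<open>a\<close> is the slope, and slope 1 means a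
  translation.\<close>

definition affine_group :: "('a::field \<times> 'a) monoid"
  where "affine_group = \<lparr>carrier = UNIV \<times> (- {0}),
    monoid.mult = (\<lambda>(x, a) (y, b). (x + a * y, a * b)), one = (0, 1)\<rparr>"

lemma affine_group_simps [simp]:
  "(x, a) \<in> carrier affine_group \<longleftrightarrow> a \<noteq> 0"
  "(x, a) \<otimes>\<^bsub>affine_group\<^esub> (y, b) = (x + a * y, a * b)"
  "\<one>\<^bsub>affine_group\<^esub> = (0, 1)"
  by (auto simp: affine_group_def)

lemma group_affine_group: "group affine_group"
proof (rule groupI)
  fix p :: "'a \<times> 'a" assume "p \<in> carrier affine_group"
  moreover obtain x a where "p = (x, a)" by (cases p)
  ultimately show "\<exists>q\<in>carrier affine_group. q \<otimes>\<^bsub>affine_group\<^esub> p = \<one>\<^bsub>affine_group\<^esub>"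
    by (intro bexI[of _ "(- x / a, 1 / a)"]) auto
qed (auto simp: affine_group_def algebra_simps)

lemma inv_affine_group [simp]:
  "a \<noteq> 0 \<Longrightarrow> inv\<^bsub>affine_group\<^esub> (x, a) = (- x / a, 1 / a)"
  by (rule group.inv_equality[OF group_affine_group]) auto

lemma nat_pow_affine_group_snd: "snd (p [^]\<^bsub>affine_group\<^esub> (n::nat)) = snd p ^ n"
  by (induction n) (auto simp: affine_group_def nat_pow_def split: prod.splits)

lemma int_pow_affine_group_snd:
  assumes "p \<in> carrier affine_group"
  shows "snd (p [^]\<^bsub>affine_group\<^esub> (k::int)) = snd p powi k"
proof -
  have "snd (inv\<^bsub>affine_group\<^esub> q) = inverse (snd q)" if "q \<in> carrier affine_group" for q :: "'a \<times> 'a"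
    using that by (cases q) (simp add: field_simps)
  moreover have "p [^]\<^bsub>affine_group\<^esub> (n::nat) \<in> carrier affine_group" for n
    by (rule monoid.nat_pow_closed[OF group.is_monoid[OF group_affine_group] assms])
  ultimately show ?thesis
    using group.int_pow_neg_int[OF group_affine_group assms]
    by (cases k rule: int_cases2) (simp_all add: int_pow_int nat_pow_affine_group_snd power_int_minus)
qed

lemma nat_pow_affine_group [simp]:
  "(0, a) [^]\<^bsub>affine_group\<^esub> (n::nat) = (0, a ^ n)"
  "(x, 1) [^]\<^bsub>affine_group\<^esub> (n::nat) = (of_nat n * x, 1)"
  by (induction n) (auto simp: nat_pow_def algebra_simps)

lemma int_pow_affine_group [simp]:
  "a \<noteq> 0 \<Longrightarrow> (0, a) [^]\<^bsub>affine_group\<^esub> (k::int) = (0, a powi k)"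
  "(x, 1) [^]\<^bsub>affine_group\<^esub> (k::int) = (of_int k * x, 1)"
  by (auto simp: int_pow_def2 power_int_def field_simps)

text \<open>Slopes multiply, so commutators have slope 1; translations commute, so the second
  derived subgroup is trivial.\<close>

lemma solvable_affine_group: "solvable (affine_group :: ('a::field \<times> 'a) monoid)"
proof -
  let ?A = "affine_group :: ('a \<times> 'a) monoid" and ?T = "UNIV \<times> {1} :: ('a \<times> 'a) set"
  interpret A: group ?A by (rule group_affine_group)
  have T: "subgroup ?T ?A" by (rule A.subgroupI) auto
  have "derived ?A (carrier ?A) \<subseteq> ?T"
    unfolding derived_def
    by (rule A.generate_subgroup_incl[OF _ T]) auto
  then have "derived ?A (derived ?A (carrier ?A)) \<subseteq> derived ?A ?T"
    by (rule A.mono_derived)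
  also have "derived ?A ?T = {\<one>\<^bsub>?A\<^esub>}"
  proof -
    interpret T: group "?A\<lparr>carrier := ?T\<rparr>" by (rule A.subgroup_imp_group[OF T])
    have "comm_group (?A\<lparr>carrier := ?T\<rparr>)"
      by (rule T.group_comm_groupI) (auto simp: add.commute)
    then show ?thesis
      using comm_group.derived_eq_singleton[of "?A\<lparr>carrier := ?T\<rparr>" ?T]
        A.derived_consistent[OF order_refl T] by simp
  qed
  finally have "(derived ?A ^^ 2) (carrier ?A) \<subseteq> {\<one>\<^bsub>?A\<^esub>}" by (simp add: numeral_2_eq_2)
  moreover have "\<one>\<^bsub>?A\<^esub> \<in> (derived ?A ^^ 2) (carrier ?A)"
    using A.exp_of_derived_is_subgroup[OF A.subgroup_self] subgroup.one_closed by blast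
  ultimately show ?thesis unfolding A.solvable_iff_trivial_derived_seq by blast
qed

section \<open>The eigenvalue\<close>

definition eigval :: real where "eigval = (5 + sqrt 17) / 2"

lemma eigval_square: "eigval * eigval = 5 * eigval - 2"
  by (simp add: eigval_def field_simps)

text \<open>Lying strictly between consecutive integers excludes \<open>eigval\<close> from the
  integers; the lower bound also makes it nonzero.\<close>

lemma eigval_bounds: "4 < eigval" "eigval < 5"
proof -
  have "3 < sqrt 17" by (rule real_less_rsqrt) simp
  then show "4 < eigval" by (simp add: eigval_def)
  have "sqrt 17 < 5" by (rule real_less_lsqrt) auto
  then show "eigval < 5" by (simp add: eigval_def)
qed

text \<open>A rational algebraic integer is an integer, and none lies strictly between 4 and
  5.\<close>

lemma eigval_irrational: "eigval \<notin> \<rat>"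
proof
  assume "eigval \<in> \<rat>"
  moreover have "algebraic_int eigval"
    by (rule algebraic_int.intros[of "[:2, -5, 1:]"])
      (auto simp: eigval_square algebra_simps coeff_pCons split: nat.splits)
  ultimately have "eigval \<in> \<int>" by (rule rational_algebraic_int_is_int[rotated])
  then obtain k where "eigval = of_int k" by (elim Ints_cases)
  with eigval_bounds have "4 < k \<and> k < 5" by (metis of_int_less_numeral_iff of_int_numeral_less_iff)
  then show False by linarith
qed

text \<open>A nonzero \<open>a\<close> would make \<open>eigval\<close> a quotient of integers. This
  independence is what embeds the base as a group of translations.\<close>

lemma eigval_lin_indep:
  fixes a b :: int
  assumes "of_int a * eigval + of_int b = 0"
  shows "a = 0 \<and> b = 0"
proof -
  have "a = 0"
  proof (rule ccontr)
    assume "a \<noteq> 0"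
    then have "eigval = of_int (- b) / of_int a"
      using assms by (simp add: field_simps)
    then have "eigval \<in> \<rat>" by (metis Rats_divide Rats_of_int)
    with eigval_irrational show False by contradiction
  qed
  with assms show ?thesis by simp
qed

text \<open>The equation for \<open>eigval\<^sup>2\<close> gives \<open>f (n + 1) = 5 f n + g n\<close> and \<open>g (n + 1) = - 2 f n\<close>; the last
  conjunct keeps the coefficients \<open>f\<close> positive.\<close>

lemma eigval_power:
  "\<exists>f g :: int. eigval ^ Suc n = of_int f * eigval + of_int g \<and> 1 \<le> f \<and> - 2 * f \<le> g"
proof (induction n)
  case 0
  show ?case by (rule exI[of _ 1], rule exI[of _ 0]) simp
next
  case (Suc n)
  then obtain f g :: int where fg: "eigval ^ Suc n = of_int f * eigval + of_int g"
    "1 \<le> f" "- 2 * f \<le> g" by blast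
  have "eigval ^ Suc (Suc n) = eigval * (of_int f * eigval + of_int g)"
    using fg(1) by simp
  also have "\<dots> = of_int f * (eigval * eigval) + of_int g * eigval"
    by (simp add: algebra_simps)
  also have "\<dots> = of_int (5 * f + g) * eigval + of_int (- 2 * f)"
    by (simp add: eigval_square algebra_simps)
  \<comment> \<open>From \<open>- 2 * f \<le> g\<close> follows
    \<open>5 * f + g \<ge> 3 * f \<ge> 1\<close>, and then
    \<open>- 2 * (5 * f + g) \<le> - 6 * f \<le> - 2 * f\<close>.\<close>
  finally show ?case using fg(2,3)
    by (intro exI[of _ "5 * f + g"] exI[of _ "- 2 * f"]) auto
qed

section \<open>Rationality of powers of the eigenvalue\<close>

lemma eigval_power_irrational: "0 < n \<Longrightarrow> eigval ^ n \<notin> \<rat>"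
proof
  assume "0 < n" and rat: "eigval ^ n \<in> \<rat>"
  then obtain f g :: int where fg: "eigval ^ n = of_int f * eigval + of_int g" "1 \<le> f"
    using eigval_power[of "n - 1"] by auto
  \<comment> \<open>The bound \<open>1 \<le> f\<close> allows solving for
    \<open>eigval\<close>.\<close>
  then have "eigval = (eigval ^ n - of_int g) / of_int f" by (simp add: field_simps)
  then have "eigval \<in> \<rat>" using rat by (metis Rats_diff Rats_divide Rats_of_int)
  with eigval_irrational show False by contradiction
qed

lemma eigval_power_int_rational:
  assumes "eigval powi k \<in> \<rat>" shows "k = 0"
proof (rule ccontr)
  assume "k \<noteq> 0"
  \<comment> \<open>A negative exponent reduces to a positive one, since the reciprocal of a
    rational is rational.\<close>
  then have "eigval ^ nat \<bar>k\<bar> \<in> \<rat>"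
    using assms Rats_inverse[OF assms] by (auto simp: power_int_def abs_if power_inverse split: if_splits)
  then show False using eigval_power_irrational[of "nat \<bar>k\<bar>"] \<open>k \<noteq> 0\<close> by simp
qed

lemma eigval_power_int_eq_1:
  "eigval powi k = 1 \<longleftrightarrow> k = 0"
  using eigval_power_int_rational[of k] by auto

lemma eigval_power_int_inj: "eigval powi j = eigval powi k \<longleftrightarrow> j = k"
proof
  assume "eigval powi j = eigval powi k"
  then have "eigval powi (j - k) = 1"
    using eigval_bounds by (simp add: power_int_diff)
  then have "j - k = 0" by (simp only: eigval_power_int_eq_1)
  then show "j = k" by simp
qed simp

text \<open>The conclusion is \<open>p^m = p\<close> rather than \<open>m = 1\<close> because
  \<open>p\<close> may be the identity, for which every \<open>m\<close> satisfies the
  hypothesis.\<close>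

lemma eigval_conjugate_is_power:
  assumes p: "snd p = eigval powi j" and q: "snd q = eigval powi r"
    and conj: "q \<otimes>\<^bsub>affine_group\<^esub> p \<otimes>\<^bsub>affine_group\<^esub> inv\<^bsub>affine_group\<^esub> q = p [^]\<^bsub>affine_group\<^esub> (m::int)"
  shows "p [^]\<^bsub>affine_group\<^esub> m = p"
proof -
  interpret M: group "affine_group :: (real \<times> real) monoid" by (rule group_affine_group)
  have eigval_nz [simp]: "eigval \<noteq> 0" using eigval_bounds by simp
  obtain y z where pq: "p = (y, eigval powi j)" "q = (z, eigval powi r)"
    using p q by (metis prod.collapse)
  then have carr: "p \<in> carrier affine_group" by simp
  \<comment> \<open>Slopes commute, so conjugation preserves the slope of \<open>p\<close>, while
    the power raises it to \<open>m\<close>.\<close>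
  have "eigval powi j = (eigval powi j) powi m"
    using arg_cong[OF conj, of snd] int_pow_affine_group_snd[OF carr, of m] pq by simp
  then have "eigval powi j = eigval powi (j * m)" by (simp add: power_int_mult)
  then have "j = j * m" by (simp only: eigval_power_int_inj)
  then consider "m = 1" | "j = 0" by auto
  then show ?thesis
  proof cases
    case 1
    then show ?thesis using carr by simp
  next
    case 2
    then have p1: "p = (y, 1)" using pq by simp
    \<comment> \<open>Conjugating the translation by \<open>y\<close> with a map of slope
      \<open>eigval powi r\<close> rescales \<open>y\<close> by that slope.\<close>
    have "eigval powi r * y = of_int m * y" using conj by (simp add: p1 pq(2))
    then consider "y = 0" | "eigval powi r = of_int m" by auto
    then show ?thesis
    proof cases
      case 2
      then have "r = 0" using eigval_power_int_rational[of r] by simp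
      with 2 show ?thesis by (simp add: p1)
    qed (simp add: p1)
  qed
qed

section \<open>The endomorphism of \<open>\<int> \<times> \<int>\<close>\<close>

lemma int_pow_DirProd:
  assumes "group G" "group H" "x \<in> carrier G" "y \<in> carrier H"
  shows "(x, y) [^]\<^bsub>G \<times>\<times> H\<^esub> (k::int) = (x [^]\<^bsub>G\<^esub> k, y [^]\<^bsub>H\<^esub> k)"
proof -
  interpret G: group G by fact
  interpret H: group H by fact
  interpret GH: group "G \<times>\<times> H" by (rule DirProd_group[OF assms(1,2)])
  have nat: "(x, y) [^]\<^bsub>G \<times>\<times> H\<^esub> (n::nat) = (x [^]\<^bsub>G\<^esub> n, y [^]\<^bsub>H\<^esub> n)" for n
    by (induction n) simp_all
  show ?thesis
    using assms by (cases k rule: int_cases2)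
      (simp_all add: int_pow_int nat G.int_pow_neg_int H.int_pow_neg_int GH.int_pow_neg_int)
qed

lemma group_ZZ: "group ZZ"
  by (intro DirProd_group group_integer_group)

lemma ZZ_decompose: "(a, b) = zz_u [^]\<^bsub>ZZ\<^esub> a \<otimes>\<^bsub>ZZ\<^esub> zz_v [^]\<^bsub>ZZ\<^esub> b"
  by (simp add: int_pow_DirProd)

lemma generate_ZZ: "generate ZZ {zz_u, zz_v} = UNIV"
proof -
  interpret Z: group ZZ by (rule group_ZZ)
  have "subgroup (generate ZZ {zz_u, zz_v}) ZZ"
    by (rule Z.generate_is_subgroup) simp
  then have "(a, b) \<in> generate ZZ {zz_u, zz_v}" for a b
    by (subst ZZ_decompose)
      (intro subgroup.m_closed Z.subgroup_int_pow_closed generate.incl; simp)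
  then show ?thesis by auto
qed

text \<open>The images of \<open>u\<close> and \<open>v\<close> determine \<theta>: its matrix has
  columns \<open>(5, -1)\<close> and \<open>(2, 0)\<close>, with trace 5 and determinant 2.\<close>

lemma ZZ_endomorphism_eq:
  assumes hom: "\<theta> \<in> hom ZZ ZZ"
    and u: "\<theta> zz_u = zz_u [^]\<^bsub>ZZ\<^esub> (5::nat) \<otimes>\<^bsub>ZZ\<^esub> inv\<^bsub>ZZ\<^esub> zz_v"
    and v: "\<theta> zz_v = zz_u [^]\<^bsub>ZZ\<^esub> (2::nat)"
  shows "\<theta> (a, b) = (5 * a + 2 * b, - a)"
proof -
  interpret \<theta>: group_hom ZZ ZZ \<theta>
    using hom by (simp add: group_hom_def group_hom_axioms_def group_ZZ)
  have u': "\<theta> zz_u = (5, -1)" and v': "\<theta> zz_v = (2, 0)"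
    unfolding u v int_pow_int[symmetric] by (simp_all add: int_pow_DirProd)
  have "\<theta> (a, b) = \<theta> zz_u [^]\<^bsub>ZZ\<^esub> a \<otimes>\<^bsub>ZZ\<^esub> \<theta> zz_v [^]\<^bsub>ZZ\<^esub> b"
    by (subst ZZ_decompose) (simp add: \<theta>.hom_int_pow del: mult_DirProd)
  also have "\<dots> = (5 * a + 2 * b, - a)"
    unfolding u' v' by (simp add: int_pow_DirProd)
  finally show ?thesis .
qed

theorem theorem2p1:
  fixes \<theta> :: "int \<times> int \<Rightarrow> int \<times> int"
  assumes "\<theta> \<in> hom ZZ ZZ"
    and "\<theta> zz_u = zz_u [^]\<^bsub>ZZ\<^esub> (5::nat) \<otimes>\<^bsub>ZZ\<^esub> inv\<^bsub>ZZ\<^esub> zz_v"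
    and "\<theta> zz_v = zz_u [^]\<^bsub>ZZ\<^esub> (2::nat)"
  shows "inj_on \<theta> (carrier ZZ)
    \<and> solvable (asc_hnn ZZ \<theta>)
    \<and> \<not> LERF (asc_hnn ZZ \<theta>)
    \<and> \<not> (\<exists>H B t. strictly_ascending_hnn (asc_hnn ZZ \<theta>) H B t
              \<and> cyclic_group ((asc_hnn ZZ \<theta>)\<lparr>carrier := B\<rparr>))"
proof -
  let ?G = "asc_hnn ZZ \<theta>" and ?t = "hnn_stable ZZ \<theta>" and ?i = "hnn_base ZZ \<theta>"
  let ?A = "affine_group :: (real \<times> real) monoid"
  note \<theta> = ZZ_endomorphism_eq[OF assms]
  interpret G: group ?G by (rule asc_hnn_group[OF group_ZZ assms(1)])
  interpret A: group ?A by (rule group_affine_group)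
  interpret i: group_hom ZZ ?G ?i
    using hnn_base_hom[OF group_ZZ assms(1)]
    by (simp add: group_hom_def group_hom_axioms_def group_ZZ G.group_axioms)
  have t [simp]: "?t \<in> carrier ?G" by (rule hnn_stable_closed[OF group_ZZ assms(1)])
  have i_closed [simp]: "?i b \<in> carrier ?G" for b by (rule i.hom_closed) (cases b; simp)
  have eigval_nz [simp]: "eigval \<noteq> 0" using eigval_bounds by simp

  text \<open>The vector \<open>(eigval, 2)\<close> is a left eigenvector of \<open>\<theta>\<close>.\<close>
  define e :: "int \<times> int \<Rightarrow> real" where "e = (\<lambda>(a, b). of_int a * eigval + of_int (2 * b))"
  have e_zero: "b = (0, 0)" if "e b = 0" for b
    using eigval_lin_indep[of "fst b" "2 * snd b"] that by (auto simp: e_def split: prod.splits)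
  have e_inj: "b = c" if "e b = e c" for b c
    using e_zero[of "(fst b - fst c, snd b - snd c)"] that
    by (auto simp: e_def algebra_simps prod_eq_iff split: prod.splits)
  have e_\<theta>: "e (\<theta> b) = eigval * e b" for b
  proof (cases b)
    case (Pair x y)
    have "eigval * e b = of_int x * (eigval * eigval) + 2 * of_int y * eigval"
      by (simp add: e_def Pair algebra_simps)
    then show ?thesis by (simp add: e_def Pair \<theta> eigval_square algebra_simps)
  qed
  have e_hom: "(\<lambda>b. (e b, 1)) \<in> hom ZZ ?A"
    by (rule homI) (auto simp: e_def algebra_simps)
  \<comment> \<open>Conjugation by the homothety of ratio \<open>eigval\<close> scales translations
    by \<open>eigval\<close>, so \<open>e_\<theta>\<close> is exactly the HNN relation in the affine
    group.\<close>
  obtain \<phi> where \<phi>: "\<phi> \<in> hom ?G ?A" and \<phi>_base: "\<And>b. \<phi> (?i b) = (e b, 1)"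
    and \<phi>_stable: "\<phi> ?t = (0, eigval)"
    by (rule asc_hnn_universal[OF group_ZZ assms(1) group_affine_group e_hom, of "(0, eigval)"])
      (auto simp: e_\<theta>)
  interpret \<phi>: group_hom ?G ?A \<phi>
    using \<phi> by unfold_locales
  \<comment> \<open>Mapping the normal form shows that every slope in the image is a power of
    \<open>eigval\<close>; the coordinates also recover \<open>e b\<close> and \<open>k - n\<close>
    once \<open>n\<close> is known.\<close>
  have \<phi>_normal_form: "\<exists>n b k. g = inv\<^bsub>?G\<^esub> (?t [^]\<^bsub>?G\<^esub> (n::nat)) \<otimes>\<^bsub>?G\<^esub> ?i b \<otimes>\<^bsub>?G\<^esub> ?t [^]\<^bsub>?G\<^esub> (k::int) \<and>
      \<phi> g = (e b / eigval ^ n, eigval powi (k - int n))"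
    if g_carr: "g \<in> carrier ?G" for g
  proof -
    obtain n b k where g: "g = inv\<^bsub>?G\<^esub> (?t [^]\<^bsub>?G\<^esub> (n::nat)) \<otimes>\<^bsub>?G\<^esub> ?i b \<otimes>\<^bsub>?G\<^esub> ?t [^]\<^bsub>?G\<^esub> (k::int)"
      by (rule asc_hnn_normal_form[OF group_ZZ assms(1) g_carr])
    then have "\<phi> g = (e b / eigval ^ n, eigval powi (k - int n))"
      by (simp add: \<phi>.hom_nat_pow \<phi>.hom_int_pow \<phi>_base \<phi>_stable power_int_diff)
    with g show ?thesis by blast
  qed
  have \<phi>_inj: "inj_on \<phi> (carrier ?G)"
  proof (rule \<phi>.inj_on_one_iff[THEN iffD2], clarify)
    fix g assume "g \<in> carrier ?G" and one: "\<phi> g = \<one>\<^bsub>?A\<^esub>"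
    then obtain n b k where g: "g = inv\<^bsub>?G\<^esub> (?t [^]\<^bsub>?G\<^esub> (n::nat)) \<otimes>\<^bsub>?G\<^esub> ?i b \<otimes>\<^bsub>?G\<^esub> ?t [^]\<^bsub>?G\<^esub> (k::int)"
      and "\<phi> g = (e b / eigval ^ n, eigval powi (k - int n))"
      using \<phi>_normal_form by blast
    \<comment> \<open>A trivial translation part makes \<open>b\<close> trivial and slope 1 gives
      \<open>k = n\<close>, so the normal form collapses to \<open>t^(-n) t^n\<close>.\<close>
    with one have "e b = 0" "eigval powi (k - int n) = 1" by auto
    then have b: "b = \<one>\<^bsub>ZZ\<^esub>" and k: "k = int n"
      using e_zero[of b] eigval_power_int_eq_1[of "k - int n"] by auto
    have "g = inv\<^bsub>?G\<^esub> (?t [^]\<^bsub>?G\<^esub> n) \<otimes>\<^bsub>?G\<^esub> \<one>\<^bsub>?G\<^esub> \<otimes>\<^bsub>?G\<^esub> ?t [^]\<^bsub>?G\<^esub> n"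
      unfolding g b k i.hom_one int_pow_int ..
    also have "\<dots> = \<one>\<^bsub>?G\<^esub>" by simp
    finally show "g = \<one>\<^bsub>?G\<^esub>" .
  qed

  \<comment> \<open>The four assertions\<close>
  have "inj_on \<theta> (carrier ZZ)"
    by (rule inj_onI) (auto simp: \<theta>)
  moreover have "solvable ?G"
    by (rule \<phi>.inj_hom_imp_solvable[OF \<phi>_inj solvable_affine_group])
  moreover have "\<not> LERF ?G"
  proof (rule G.strictly_ascending_not_LERF[OF t, of "?i ` {zz_u, zz_v}"])
    have gen: "generate ?G (?i ` {zz_u, zz_v}) = range ?i"
      by (subst i.generate_img) (simp_all only: generate_ZZ, simp)
    have rel: "?t \<otimes>\<^bsub>?G\<^esub> ?i b \<otimes>\<^bsub>?G\<^esub> inv\<^bsub>?G\<^esub> ?t = ?i (\<theta> b)" for b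
      by (rule asc_hnn_relation[OF group_ZZ assms(1)]) (cases b; simp)
    \<comment> \<open>Strictness is a parity argument: \<open>\<theta> b = (1, 0)\<close> forces the
      first coordinate of \<open>b\<close> to be 0 and twice the second to be 1.\<close>
    have "?i zz_u \<noteq> ?i (\<theta> b)" for b
    proof
      assume "?i zz_u = ?i (\<theta> b)"
      then have "zz_u = \<theta> b" using \<phi>_base e_inj by (metis prod.inject)
      then have "2 * snd b = 1" using \<theta>[of "fst b" "snd b"] by simp
      then show False by presburger
    qed
    then show "(\<lambda>b. ?t \<otimes>\<^bsub>?G\<^esub> b \<otimes>\<^bsub>?G\<^esub> inv\<^bsub>?G\<^esub> ?t) ` generate ?G (?i ` {zz_u, zz_v})
        \<subset> generate ?G (?i ` {zz_u, zz_v})"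
      unfolding gen image_image rel by blast
  qed auto
  moreover have False
    if hnn: "strictly_ascending_hnn ?G H B s" and cyc: "cyclic_group (?G\<lparr>carrier := B\<rparr>)" for H B s
  proof -
    let ?c = "\<lambda>b. s \<otimes>\<^bsub>?G\<^esub> b \<otimes>\<^bsub>?G\<^esub> inv\<^bsub>?G\<^esub> s"
    have "subgroup H ?G" "s \<in> H" and B: "subgroup B ?G" and strict: "?c ` B \<subset> B"
      using hnn unfolding strictly_ascending_hnn_def by blast+
    then have s: "s \<in> carrier ?G" by (blast dest: subgroup.mem_carrier)
    interpret c: group_hom ?G ?G ?c
      using G.conjugation_hom[OF s] by (simp add: group_hom_def group_hom_axioms_def G.group_axioms)
    obtain x where x: "x \<in> B" and B_eq: "B = range (\<lambda>k::int. x [^]\<^bsub>?G\<^esub> k)"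
      using cyc unfolding group.cyclic_group[OF G.subgroup_imp_group[OF B]]
      by (auto simp: G.int_pow_consistent[OF B, symmetric])
    have x_carr: "x \<in> carrier ?G" by (rule subgroup.mem_carrier[OF B x])
    \<comment> \<open>The conjugate of the generator \<open>x\<close> stays in the cyclic base, so
      it is a power of \<open>x\<close>.\<close>
    obtain m :: int where m: "?c x = x [^]\<^bsub>?G\<^esub> m" using strict x B_eq by blast
    obtain j r where "snd (\<phi> x) = eigval powi j" "snd (\<phi> s) = eigval powi r"
      using \<phi>_normal_form[OF x_carr] \<phi>_normal_form[OF s] by (metis snd_conv)
    moreover have "\<phi> s \<otimes>\<^bsub>?A\<^esub> \<phi> x \<otimes>\<^bsub>?A\<^esub> inv\<^bsub>?A\<^esub> \<phi> s = \<phi> x [^]\<^bsub>?A\<^esub> m"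
      using arg_cong[OF m, of \<phi>] s x_carr by (simp add: \<phi>.hom_int_pow)
    ultimately have "\<phi> x [^]\<^bsub>?A\<^esub> m = \<phi> x" by (rule eigval_conjugate_is_power)
    \<comment> \<open>Injectivity of \<phi> carries the identity back: \<open>s\<close> commutes
      with \<open>x\<close>, hence fixes every element of \<open>B\<close> under conjugation, and
      the inclusion is not strict.\<close>
    then have "x [^]\<^bsub>?G\<^esub> m = x"
      using x_carr by (intro inj_onD[OF \<phi>_inj]) (simp_all add: \<phi>.hom_int_pow)
    then have "?c (x [^]\<^bsub>?G\<^esub> k) = x [^]\<^bsub>?G\<^esub> k" for k :: int
      using c.hom_int_pow[OF x_carr, of k] m by simp
    then have "?c ` B = B" unfolding B_eq image_image by simp
    with strict show False by simp
  qed
  ultimately show ?thesis by blast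
qed

end
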